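(* Let $m\ge 2$, let $n$ be an even positive integer, and let $r$ be an integer with $n>r\ge 0$. Then $\chi_{lat}(A(mK_n,K_r))=n$.
   Context: All graphs are finite and simple. For a graph $G$ with $p$ vertices and $q$ edges, a local antimagic total labeling of $G$ is a bijection $f:V(G)\cup E(G)\to\{1,2,\ldots,p+q\}$ such that $w_f(u)\neq w_f(v)$ for every edge $uv\in E(G)$, where $w_f(u)=f(u)+\sum_{uv\in E(G)}f(uv)$ is the weight of $u$ (the sum is over all edges incident to $u$). The local antimagic total chromatic number $\chi_{lat}(G)$ is the minimum, over all local antimagic total labelings $f$ of $G$, of the number of distinct values of $w_f$ on $V(G)$. (It is known that every graph has a local antimagic total labeling.) For $m\ge 2$ and $n>r\ge 1$, $A(mK_n,K_r)$ denotes the amalgamation of $m$ copies of the complete graph $K_n$ over $K_r$: the simple graph obtained from $m$ copies of $K_n$ by choosing a $K_r$ in each copy and identifying these $m$ copies of $K_r$ into a single $K_r$. Equivalently, it is the join $(mK_{n-r})\vee K_r$, where $mK_{n-r}$ is the disjoint union of $m$ copies of $K_{n-r}$. By convention $A(mK_n,K_0)=mK_n$, the disjoint union of $m$ copies of $K_n$. *)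

theory Defs
  imports Main
begin

text \<open>
  A graph is a pair \<open>(V, E)\<close> of a vertex set and a set of undirected edges, each edge being the
  set of its two end vertices.
\<close>

type_synonym 'a graph = "'a set \<times> 'a set set"

abbreviation verts :: "'a graph \<Rightarrow> 'a set" where
  "verts G \<equiv> fst G"

abbreviation edges :: "'a graph \<Rightarrow> 'a set set" where
  "edges G \<equiv> snd G"

definition fin_simple_graph :: "'a graph \<Rightarrow> bool" where
  "fin_simple_graph G \<longleftrightarrow> finite (verts G) \<and> edges G \<subseteq> {e. e \<subseteq> verts G \<and> card e = 2}"

text \<open>
  A total labeling is a function on the disjoint sum of vertices (\<open>Inl\<close>) and edges (\<open>Inr\<close>).
\<close>

definition weight :: "'a graph \<Rightarrow> ('a + 'a set \<Rightarrow> nat) \<Rightarrow> 'a \<Rightarrow> nat" where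
  "weight G f u = f (Inl u) + (\<Sum>e\<in>{e \<in> edges G. u \<in> e}. f (Inr e))"

definition local_antimagic_total :: "'a graph \<Rightarrow> ('a + 'a set \<Rightarrow> nat) \<Rightarrow> bool" where
  "local_antimagic_total G f \<longleftrightarrow>
     bij_betw f (verts G <+> edges G) {1..card (verts G) + card (edges G)} \<and>
     (\<forall>u v. {u, v} \<in> edges G \<longrightarrow> weight G f u \<noteq> weight G f v)"

definition chi_lat :: "'a graph \<Rightarrow> nat" where
  "chi_lat G = (LEAST k. \<exists>f. local_antimagic_total G f \<and> card (weight G f ` verts G) = k)"

definition complete_graph :: "'a set \<Rightarrow> 'a graph" where
  "complete_graph V = (V, {e. e \<subseteq> V \<and> card e = 2})"

definition copies :: "nat \<Rightarrow> 'a graph \<Rightarrow> (nat \<times> 'a) graph" where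
  "copies m G = ({..<m} \<times> verts G, {Pair i ` e | i e. i < m \<and> e \<in> edges G})"

text \<open>
  The vertices \<open>(i, v)\<close>, \<open>i < m\<close>, with \<open>v \<in> S\<close> become one vertex, represented by \<open>(0, v)\<close>; edges
  that become equal are merged, since the edges form a set.
\<close>

definition glue :: "'a set \<Rightarrow> nat \<times> 'a \<Rightarrow> nat \<times> 'a" where
  "glue S x = (if snd x \<in> S then (0, snd x) else x)"

definition amalgamation :: "nat \<Rightarrow> 'a graph \<Rightarrow> 'a set \<Rightarrow> (nat \<times> 'a) graph" where
  "amalgamation m G S =
     (glue S ` verts (copies m G), (\<lambda>e. glue S ` e) ` edges (copies m G))"

text \<open>The graph \<open>A(mK\<^sub>n, K\<^sub>r)\<close>.\<close>

definition amalg_complete :: "nat \<Rightarrow> nat \<Rightarrow> nat \<Rightarrow> (nat \<times> nat) graph" where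
  "amalg_complete m n r = amalgamation m (complete_graph {..<n}) {..<r}"

lemma amalg_complete_0: "amalg_complete m n 0 = copies m (complete_graph {..<n})"
proof -
  have "glue {} = (id :: nat \<times> nat \<Rightarrow> _)" by (auto simp: glue_def)
  then show ?thesis by (simp add: amalg_complete_def amalgamation_def)
qed

text \<open>The join description \<open>(mK\<^bsub>n-r\<^esub>) \<or> K\<^sub>r\<close>.\<close>

lemma verts_amalg_complete:
  assumes "0 < m" "r \<le> n"
  shows "verts (amalg_complete m n r) = {0} \<times> {..<r} \<union> {..<m} \<times> {r..<n}"
proof
  show "verts (amalg_complete m n r) \<subseteq> {0} \<times> {..<r} \<union> {..<m} \<times> {r..<n}"
    by (auto simp: amalg_complete_def amalgamation_def copies_def complete_graph_def glue_def)
  show "{0} \<times> {..<r} \<union> {..<m} \<times> {r..<n} \<subseteq> verts (amalg_complete m n r)"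
  proof
    fix x assume "x \<in> {0} \<times> {..<r} \<union> {..<m} \<times> {r..<n}"
    then have "x = glue {..<r} x" "x \<in> {..<m} \<times> {..<n}"
      using assms by (auto simp: glue_def)
    then show "x \<in> verts (amalg_complete m n r)"
      by (auto simp: amalg_complete_def amalgamation_def copies_def complete_graph_def)
  qed
qed

lemma edges_amalg_complete:
  assumes "0 < m" "r \<le> n"
  shows "edges (amalg_complete m n r) =
    {{x, y} | x y. x \<in> verts (amalg_complete m n r) \<and> y \<in> verts (amalg_complete m n r) \<and>
       x \<noteq> y \<and> (snd x < r \<or> snd y < r \<or> fst x = fst y)}" (is "?L = ?R")
proof
  show "?L \<subseteq> ?R"
  proof
    fix e assume "e \<in> ?L"
    then obtain i d where id: "i < m" "d \<subseteq> {..<n}" "card d = 2" "e = glue {..<r} ` Pair i ` d"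
      by (auto simp: amalg_complete_def amalgamation_def copies_def complete_graph_def)
    then obtain a b where d: "d = {a, b}" "a \<noteq> b" by (auto simp: card_2_iff)
    let ?x = "glue {..<r} (i, a)" and ?y = "glue {..<r} (i, b)"
    have "e = {?x, ?y}" "?x \<noteq> ?y" "snd ?x < r \<or> snd ?y < r \<or> fst ?x = fst ?y"
      using id d by (auto simp: glue_def)
    moreover have "?x \<in> verts (amalg_complete m n r)" "?y \<in> verts (amalg_complete m n r)"
      using id d by (auto simp: amalg_complete_def amalgamation_def copies_def complete_graph_def)
    ultimately show "e \<in> ?R" by blast
  qed
  show "?R \<subseteq> ?L"
  proof
    fix e assume "e \<in> ?R"
    then obtain x y where e: "e = {x, y}" "x \<in> verts (amalg_complete m n r)"
      "y \<in> verts (amalg_complete m n r)" "x \<noteq> y" "snd x < r \<or> snd y < r \<or> fst x = fst y"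
      by blast
    define i where "i = (if snd x < r then fst y else fst x)"
    have "i < m" "{snd x, snd y} \<subseteq> {..<n}" "snd x \<noteq> snd y"
      "x = glue {..<r} (i, snd x)" "y = glue {..<r} (i, snd y)"
      using e assms by (auto simp: verts_amalg_complete i_def glue_def split: if_splits)
    then have "{snd x, snd y} \<in> edges (complete_graph {..<n})"
      "e = glue {..<r} ` Pair i ` {snd x, snd y}"
      using e(1) by (auto simp: complete_graph_def)
    with \<open>i < m\<close> show "e \<in> ?L"
      unfolding amalg_complete_def amalgamation_def copies_def snd_conv by blast
  qed
qed

lemma fin_simple_graph_amalg_complete:
  assumes "0 < m" "r \<le> n"
  shows "fin_simple_graph (amalg_complete m n r)"
  using assms unfolding fin_simple_graph_def edges_amalg_complete[OF assms]
  by (auto simp: verts_amalg_complete)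

end

theory Submission
  imports Defs "HOL-Library.Nat_Bijection"
begin

text \<open>
  Call \<open>v\<close> the column of the vertex \<open>(i, v)\<close>, and call the columns below \<open>r\<close> the hub. The vertices
  \<open>(0, v)\<close>, \<open>v < n\<close>, form a clique, so their weights are distinct in every local antimagic total
  labeling; this gives the lower bound \<open>n\<close> (\<open>card_weights_ge\<close>).

  For the upper bound it suffices to find a labeling in which the weight of a vertex depends only
  on its column and is injective in the column, since adjacent vertices lie in different columns.
  View the labels of the \<open>i\<close>-th copy of \<open>K\<^sub>n\<close> as a symmetric \<open>n \<times> n\<close> matrix, with the vertex labels
  on the diagonal. A cell of two hub columns is shared by all copies; every other cell occurs in
  \<open>m\<close> versions, one for each copy. The weight of a vertex outside the hub is a row sum of its
  matrix. List the cells \<open>{a, b}\<close> with \<open>a \<le> b\<close> colexicographically; the hub cells come first.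
  Along this list the labels are given out downwards: one label to each hub cell, then a block of
  \<open>m\<close> consecutive labels to each other cell. Two observations make this work.

  \<^item> Let the labels within the block of \<open>{a, b}\<close> increase with the copy if \<open>a + b\<close> is even, and
    decrease otherwise. As \<open>n\<close> is even, each row has as many increasing as decreasing cells, so
    going to another copy does not change the row sums (\<open>pair_label_row_sum\<close>).

  \<^item> For fixed \<open>b\<close> the rank of \<open>{a, b}\<close> strictly increases with \<open>a\<close>. So an entry of row \<open>u\<close> exceeds
    the entry of each later row in the same position, whichever copies the two are taken from
    (\<open>pair_label_strict_antimono\<close>). Hence the weights strictly decrease with the column
    (\<open>weight_strict_antimono\<close>). This includes hub columns, whose weights add up the versions from
    all the copies.
\<close>

section \<open>Colexicographic ranking of unordered pairs\<close>

lemma strict_mono_triangle: "strict_mono triangle"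
  unfolding strict_mono_Suc_iff by simp

definition cell :: "nat \<Rightarrow> nat \<Rightarrow> nat" where
  "cell a b = triangle (max a b) + min a b"

lemma cell_commute: "cell a b = cell b a"
  by (simp add: cell_def max.commute min.commute)

lemma cell_eq_prod_encode: "a \<le> b \<Longrightarrow> cell a b = prod_encode (a, b - a)"
  by (simp add: cell_def prod_encode_def)

lemma cell_inject:
  assumes "a \<le> b" "a' \<le> b'" "cell a b = cell a' b'"
  shows "a = a' \<and> b = b'"
  using assms by (auto simp: cell_eq_prod_encode)

lemma cell_surj: obtains a b where "a \<le> b" "c = cell a b"
proof -
  obtain a d where "prod_decode c = (a, d)" by fastforce
  then have "c = prod_encode (a, d)" by (metis prod_decode_inverse)
  then have "c = cell a (a + d)" by (simp add: cell_eq_prod_encode)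
  with that[of a "a + d"] show thesis by simp
qed

text \<open>The pairs below \<open>r\<close> form an initial segment of the ranking: hub cells come first.\<close>

lemma cell_less_triangle_iff: "cell a b < triangle r \<longleftrightarrow> max a b < r"
proof
  assume "cell a b < triangle r"
  then have "triangle (max a b) < triangle r" by (simp add: cell_def)
  then show "max a b < r" using strict_mono_less[OF strict_mono_triangle] by blast
next
  assume "max a b < r"
  then have "triangle (Suc (max a b)) \<le> triangle r"
    using strict_mono_less_eq[OF strict_mono_triangle] Suc_leI by blast
  then show "cell a b < triangle r" by (simp add: cell_def)
qed

lemma cell_strict_mono:
  assumes "u < v"
  shows "cell u b < cell v b"
proof -
  have "triangle u < triangle v" using strict_monoD[OF strict_mono_triangle assms] .
  moreover have "triangle b < triangle v" if "b < v"
    using strict_monoD[OF strict_mono_triangle that] .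
  ultimately show ?thesis using assms by (auto simp: cell_def max_def min_def)
qed

section \<open>The matrix of labels\<close>

text \<open>
  The label of the cell \<open>{a, b}\<close> in copy \<open>i\<close>. There are \<open>triangle r\<close> hub cells and
  \<open>triangle n - triangle r\<close> blocks of length \<open>m\<close>. The blocks use the labels up to
  \<open>m * (triangle n - triangle r)\<close>, and the hub cells those above. The last cell has rank
  \<open>triangle n - 1\<close> and takes the lowest block.
\<close>

definition pair_label :: "nat \<Rightarrow> nat \<Rightarrow> nat \<Rightarrow> nat \<Rightarrow> nat \<Rightarrow> nat \<Rightarrow> nat" where
  "pair_label m n r i a b =
     (if max a b < r then m * (triangle n - triangle r) + (triangle r - cell a b)
      else m * (triangle n - 1 - cell a b) + (if even (a + b) then i + 1 else m - i))"

lemma pair_label_commute: "pair_label m n r i a b = pair_label m n r i b a"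
  by (simp add: pair_label_def cell_commute[of a b] max.commute add.commute)

lemma pair_label_hub: "max a b < r \<Longrightarrow> pair_label m n r i a b = pair_label m n r j a b"
  by (simp add: pair_label_def)

text \<open>
  Normal form for the labels outside the hub, with an offset \<open>t < m\<close> from the start of the block:
  division by \<open>m\<close> then recovers both the cell and the copy.
\<close>

lemma pair_label_block:
  assumes "i < m" "\<not> max a b < r"
  obtains t where "t < m" "t = (if even (a + b) then i else m - 1 - i)"
    "pair_label m n r i a b = m * (triangle n - 1 - cell a b) + t + 1"
proof (rule that)
  show "(if even (a + b) then i else m - 1 - i) < m" using assms(1) by simp
  show "pair_label m n r i a b =
      m * (triangle n - 1 - cell a b) + (if even (a + b) then i else m - 1 - i) + 1"
    unfolding pair_label_def if_not_P[OF assms(2)] using assms(1) by auto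
qed simp

lemma pair_label_le_blocks:
  assumes "i < m" "\<not> max a b < r" "max a b < n"
  shows "pair_label m n r i a b \<le> m * (triangle n - triangle r)"
proof -
  obtain t where t: "t < m" "pair_label m n r i a b = m * (triangle n - 1 - cell a b) + t + 1"
    using assms pair_label_block by metis
  have "cell a b < triangle n" "triangle r \<le> cell a b"
    using assms cell_less_triangle_iff by (auto simp: not_less[symmetric])
  then have "triangle n - 1 - cell a b + 1 \<le> triangle n - triangle r" by linarith
  then have "m * (triangle n - 1 - cell a b + 1) \<le> m * (triangle n - triangle r)"
    by (rule mult_le_mono2)
  with t show ?thesis by simp
qed

lemma pair_label_gt_blocks:
  assumes "max a b < r"
  shows "m * (triangle n - triangle r) < pair_label m n r i a b"
  using assms cell_less_triangle_iff[of a b r] by (simp add: pair_label_def)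

lemma pair_label_inject:
  assumes "a \<le> b" "b < n" "i < m" "a' \<le> b'" "b' < n" "i' < m"
    and eq: "pair_label m n r i a b = pair_label m n r i' a' b'"
  shows "a = a' \<and> b = b' \<and> (b < r \<or> i = i')"
proof (cases "b < r")
  case True
  then have b': "b' < r"
    using eq assms pair_label_gt_blocks[of a b r m n i] pair_label_le_blocks[of i' m a' b' r n]
    by (metis leD max.absorb2)
  have "cell a b < triangle r" "cell a' b' < triangle r"
    using True b' assms by (auto simp: cell_less_triangle_iff)
  then have "cell a b = cell a' b'"
    using eq True b' assms by (simp add: pair_label_def)
  then show ?thesis using cell_inject assms True by blast
next
  case False
  then have b': "\<not> b' < r"
    using eq assms pair_label_gt_blocks[of a' b' r m n i'] pair_label_le_blocks[of i m a b r n]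
    by (metis leD max.absorb2)
  obtain t where t: "t < m" "t = (if even (a + b) then i else m - 1 - i)"
    "pair_label m n r i a b = m * (triangle n - 1 - cell a b) + t + 1"
    using pair_label_block[of i m a b r] False assms by (metis max.absorb2)
  obtain t' where t': "t' < m" "t' = (if even (a' + b') then i' else m - 1 - i')"
    "pair_label m n r i' a' b' = m * (triangle n - 1 - cell a' b') + t' + 1"
    using pair_label_block[of i' m a' b' r] b' assms by (metis max.absorb2)
  have "m * (triangle n - 1 - cell a b) + t = m * (triangle n - 1 - cell a' b') + t'"
    using eq t t' by simp
  then have q: "triangle n - 1 - cell a b = triangle n - 1 - cell a' b'" and "t = t'"
    using t(1) t'(1)
    by (metis div_mult_self4 div_less add_0_right less_zeroE,
        metis mod_mult_self4 mod_less)
  have "cell a b < triangle n" "cell a' b' < triangle n"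
    using assms by (auto simp: cell_less_triangle_iff)
  with q have "cell a b = cell a' b'" by linarith
  then have ab: "a = a'" "b = b'" using cell_inject assms by blast+
  with \<open>t = t'\<close> t(2) t'(2) assms(3,6) have "i = i'" by (auto split: if_splits)
  with ab show ?thesis by simp
qed

lemma pair_label_surj:
  assumes "k \<in> {1..m * (triangle n - triangle r) + triangle r}" "r < n" "0 < m"
  obtains i a b where "i < m" "a \<le> b" "b < n" "pair_label m n r i a b = k"
proof (cases "k \<le> m * (triangle n - triangle r)")
  case True
  define q where "q = (k - 1) div m"
  define t where "t = (k - 1) mod m"
  have k: "k = m * q + t + 1" "t < m" using assms by (auto simp: q_def t_def)
  have "m * q < m * (triangle n - triangle r)" using True k by linarith
  then have q: "q < triangle n - triangle r" by simp
  obtain a b where ab: "a \<le> b" "triangle n - 1 - q = cell a b" by (rule cell_surj)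
  have "cell a b < triangle n" "\<not> cell a b < triangle r" "triangle n - 1 - cell a b = q"
    using q ab(2) by linarith+
  then have b: "b < n" "\<not> b < r"
    using ab(1) by (auto simp: cell_less_triangle_iff)
  define i where "i = (if even (a + b) then t else m - 1 - t)"
  have "i < m" using k by (auto simp: i_def)
  moreover have "pair_label m n r i a b = k"
    using b ab(1) k \<open>triangle n - 1 - cell a b = q\<close> by (auto simp: pair_label_def i_def)
  ultimately show thesis using that ab b by blast
next
  case False
  obtain a b where ab: "a \<le> b" "m * (triangle n - triangle r) + triangle r - k = cell a b"
    by (rule cell_surj)
  have "cell a b < triangle r" "triangle r - cell a b = k - m * (triangle n - triangle r)"
    using ab(2) False assms(1) by auto
  moreover from this have "b < r" using ab by (auto simp: cell_less_triangle_iff)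
  ultimately have "pair_label m n r 0 a b = k" using False ab by (simp add: pair_label_def)
  then show thesis using that[of 0 a b] ab \<open>b < r\<close> assms by auto
qed

text \<open>
  The copies \<open>i\<close> and \<open>j\<close> are arbitrary because different cells have disjoint blocks. This freedom
  is what allows weights in the hub, which mix the copies, to be compared with all others.
\<close>

lemma pair_label_strict_antimono:
  assumes "u < v" "v < n" "b < n" "r < n" "i < m" "j < m"
  shows "pair_label m n r j v b < pair_label m n r i u b"
proof -
  have c: "cell u b < cell v b" using cell_strict_mono assms(1) .
  have n: "cell v b < triangle n" using assms by (auto simp: cell_less_triangle_iff)
  consider "max v b < r" "max u b < r" | "\<not> max v b < r" "max u b < r" | "\<not> max v b < r" "\<not> max u b < r"
    using assms by linarith
  then show ?thesis
  proof cases
    case 1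
    then have "cell v b < triangle r" by (simp add: cell_less_triangle_iff)
    then show ?thesis using 1 c by (simp add: pair_label_def)
  next
    case 2
    then show ?thesis
      using pair_label_gt_blocks[of u b r m n i] pair_label_le_blocks[of j m v b r n] assms
      by auto
  next
    case 3
    obtain t where t: "t < m" "pair_label m n r i u b = m * (triangle n - 1 - cell u b) + t + 1"
      using pair_label_block[of i m u b r] 3 assms by metis
    obtain s where s: "s < m" "pair_label m n r j v b = m * (triangle n - 1 - cell v b) + s + 1"
      using pair_label_block[of j m v b r] 3 assms by metis
    have "triangle n - 1 - cell v b + 1 \<le> triangle n - 1 - cell u b" using c n by linarith
    then have "m * (triangle n - 1 - cell v b + 1) \<le> m * (triangle n - 1 - cell u b)"
      by (rule mult_le_mono2)
    then show ?thesis using s t by simp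
  qed
qed

text \<open>Two neighbouring cells of a row have opposite parities, and their offsets add up to \<open>m + 1\<close>.\<close>

lemma alternating_offsets_sum:
  fixes i m h v :: nat
  assumes "i < m"
  shows "(\<Sum>b<2 * h. if even (v + b) then i + 1 else m - i) = h * (m + 1)"
  using assms by (induction h) auto

lemma pair_label_row_sum:
  assumes "even n" "i < m" "j < m" "r \<le> v"
  shows "(\<Sum>b<n. pair_label m n r i v b) = (\<Sum>b<n. pair_label m n r j v b)"
proof -
  obtain h where h: "n = 2 * h" using assms(1) by blast
  have "(\<Sum>b<n. pair_label m n r i v b) =
      (\<Sum>b<n. m * (triangle n - 1 - cell v b)) + h * (m + 1)" if "i < m" for i
  proof -
    have "(\<Sum>b<n. pair_label m n r i v b) =
        (\<Sum>b<n. m * (triangle n - 1 - cell v b) + (if even (v + b) then i + 1 else m - i))"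
      using assms(4) by (intro sum.cong) (auto simp: pair_label_def)
    also have "\<dots> = (\<Sum>b<n. m * (triangle n - 1 - cell v b)) +
        (\<Sum>b<2 * h. if even (v + b) then i + 1 else m - i)"
      by (simp add: sum.distrib h)
    finally show ?thesis by (simp only: alternating_offsets_sum[OF that])
  qed
  then show ?thesis using assms by metis
qed

section \<open>The labeling of the amalgamation\<close>

text \<open>
  The vertex or edge of the amalgamation that occupies the cell \<open>{a, b}\<close> in copy \<open>i\<close>. A vertex is
  encoded as the singleton obtained for \<open>a = b\<close>, so vertices and edges are treated alike.
\<close>

definition copy_pair :: "nat \<Rightarrow> nat \<Rightarrow> nat \<Rightarrow> nat \<Rightarrow> (nat \<times> nat) set" where
  "copy_pair r i a b = {glue {..<r} (i, a), glue {..<r} (i, b)}"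

text \<open>
  The copy can be read off as a maximum: if the first components of the two ends differ, then one
  end is a hub vertex, represented with first component \<open>0\<close>.
\<close>

definition set_label :: "nat \<Rightarrow> nat \<Rightarrow> nat \<Rightarrow> (nat \<times> nat) set \<Rightarrow> nat" where
  "set_label m n r e = pair_label m n r (Max (fst ` e)) (Min (snd ` e)) (Max (snd ` e))"

definition total_label :: "nat \<Rightarrow> nat \<Rightarrow> nat \<Rightarrow> (nat \<times> nat) + (nat \<times> nat) set \<Rightarrow> nat" where
  "total_label m n r = set_label m n r \<circ> case_sum (\<lambda>x. {x}) id"

lemma set_label_doubleton:
  "set_label m n r {(i, a), (j, b)} = pair_label m n r (max i j) a b"
  by (cases "a \<le> b") (auto simp: set_label_def max_def min_def pair_label_commute)

lemma set_label_copy_pair: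
  "set_label m n r (copy_pair r i a b) = pair_label m n r i a b"
  by (auto simp: copy_pair_def glue_def set_label_doubleton intro: pair_label_hub)

text \<open>
  Vertices become sets of size \<open>1\<close> and edges are sets of size \<open>2\<close>, so the two kinds do not collide.
\<close>

lemma bij_betw_copy_pairs:
  assumes "0 < m" "r < n"
  shows "bij_betw (case_sum (\<lambda>x. {x}) id)
    (verts (amalg_complete m n r) <+> edges (amalg_complete m n r))
    {copy_pair r i a b | i a b. i < m \<and> a \<le> b \<and> b < n}" (is "bij_betw ?h (?V <+> ?E) ?D")
proof -
  have E2: "card e = 2" if "e \<in> ?E" for e
    using fin_simple_graph_amalg_complete[of m r n] assms that
    by (auto simp: fin_simple_graph_def)
  have V: "?V = {glue {..<r} (i, a) | i a. i < m \<and> a < n}"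
    by (auto simp: amalg_complete_def amalgamation_def copies_def complete_graph_def)
  have E: "?E = {copy_pair r i a b | i a b. i < m \<and> a < b \<and> b < n}" (is "_ = ?R")
  proof (intro equalityI subsetI)
    fix e assume "e \<in> ?E"
    then obtain i d where id: "i < m" "d \<subseteq> {..<n}" "card d = 2" "e = glue {..<r} ` Pair i ` d"
      by (auto simp: amalg_complete_def amalgamation_def copies_def complete_graph_def)
    then obtain a b where d: "d = {a, b}" "a < b"
      by (auto simp: card_2_iff) (metis insert_commute linorder_neqE_nat)
    with id show "e \<in> ?R" by (auto simp: copy_pair_def)
  next
    fix e assume "e \<in> ?R"
    then obtain i a b where e: "e = glue {..<r} ` Pair i ` {a, b}" "i < m" "a < b" "b < n"
      by (auto simp: copy_pair_def)
    then have "{a, b} \<in> edges (complete_graph {..<n})" by (auto simp: complete_graph_def)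
    then show "e \<in> ?E" using e
      unfolding amalg_complete_def amalgamation_def copies_def snd_conv by blast
  qed
  have "inj_on ?h (?V <+> ?E)"
    using E2 by (auto simp: inj_on_def) fastforce+
  moreover have "?h ` (?V <+> ?E) = (\<lambda>x. {x}) ` ?V \<union> ?E"
    by (simp add: Plus_def image_Un image_image)
  moreover have "(\<lambda>x. {x}) ` ?V = {copy_pair r i a b | i a b. i < m \<and> a = b \<and> b < n}"
    unfolding V copy_pair_def by auto
  then have "(\<lambda>x. {x}) ` ?V \<union> ?E = ?D"
    unfolding E by (auto simp: le_less)
  ultimately show ?thesis by (simp add: bij_betw_def)
qed

lemma bij_betw_total_label:
  assumes "0 < m" "r < n"
  shows "bij_betw (total_label m n r)
    (verts (amalg_complete m n r) <+> edges (amalg_complete m n r))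
    {1..card (verts (amalg_complete m n r)) + card (edges (amalg_complete m n r))}"
    (is "bij_betw _ (?V <+> ?E) _")
proof -
  let ?D = "{copy_pair r i a b | i a b. i < m \<and> a \<le> b \<and> b < n}"
  let ?K = "m * (triangle n - triangle r) + triangle r"
  have "inj_on (set_label m n r) ?D"
  proof (rule inj_onI)
    fix d e assume "d \<in> ?D" "e \<in> ?D" and eq: "set_label m n r d = set_label m n r e"
    then obtain i a b j a' b' where d: "d = copy_pair r i a b" "i < m" "a \<le> b" "b < n"
      and e: "e = copy_pair r j a' b'" "j < m" "a' \<le> b'" "b' < n" by blast
    then have "pair_label m n r i a b = pair_label m n r j a' b'"
      using eq by (simp add: set_label_copy_pair)
    from pair_label_inject[OF d(3,4,2) e(3,4,2) this] have "a = a'" "b = b'" "b < r \<or> i = j" by auto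
    then show "d = e" using d(1,3) e(1) by (auto simp: copy_pair_def glue_def)
  qed
  moreover have "set_label m n r ` ?D = {1..?K}"
  proof (intro equalityI subsetI)
    fix k assume "k \<in> set_label m n r ` ?D"
    then obtain i a b where k: "k = pair_label m n r i a b" "i < m" "a \<le> b" "b < n"
      by (auto simp: set_label_copy_pair)
    show "k \<in> {1..?K}"
    proof (cases "b < r")
      case True
      then show ?thesis using k pair_label_gt_blocks[of a b r m n i] by (auto simp: pair_label_def)
    next
      case False
      then show ?thesis using k pair_label_le_blocks[of i m a b r n] by (auto simp: pair_label_def)
    qed
  next
    fix k assume "k \<in> {1..?K}"
    then obtain i a b where "i < m" "a \<le> b" "b < n" "pair_label m n r i a b = k"
      using pair_label_surj assms by metis
    then have "copy_pair r i a b \<in> ?D" "k = set_label m n r (copy_pair r i a b)"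
      by (auto simp: set_label_copy_pair)
    then show "k \<in> set_label m n r ` ?D" by blast
  qed
  ultimately have "bij_betw (set_label m n r) ?D {1..?K}" by (simp add: bij_betw_def)
  then have bij: "bij_betw (total_label m n r) (?V <+> ?E) {1..?K}"
    unfolding total_label_def using bij_betw_trans[OF bij_betw_copy_pairs[OF assms]] by blast
  have "finite ?V"
    using fin_simple_graph_amalg_complete[of m r n] assms by (auto simp: fin_simple_graph_def)
  moreover have "finite (?V <+> ?E)" using bij bij_betw_finite by blast
  ultimately have "card (?V <+> ?E) = card ?V + card ?E"
    by (metis card_Plus finite_Plus_iff)
  \<comment> \<open>The bijection onto \<open>{1..?K}\<close> itself counts the vertices and edges.\<close>
  then have "?K = card ?V + card ?E"
    using bij_betw_same_card[OF bij] by simp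
  with bij show ?thesis by metis
qed

section \<open>Weights\<close>

lemma doubleton_in_edges_iff:
  assumes "0 < m" "r < n"
  shows "{x, y} \<in> edges (amalg_complete m n r) \<longleftrightarrow>
    x \<in> verts (amalg_complete m n r) \<and> y \<in> verts (amalg_complete m n r) \<and>
    x \<noteq> y \<and> (snd x < r \<or> snd y < r \<or> fst x = fst y)" (is "?L \<longleftrightarrow> ?R")
proof
  assume ?L
  then obtain x' y' where xy: "{x, y} = {x', y'}" "x' \<in> verts (amalg_complete m n r)"
    "y' \<in> verts (amalg_complete m n r)" "x' \<noteq> y'" "snd x' < r \<or> snd y' < r \<or> fst x' = fst y'"
    using edges_amalg_complete[of m r n] assms by auto
  from xy(1) consider "x = x'" "y = y'" | "x = y'" "y = x'" unfolding doubleton_eq_iff by blast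
  then show ?R using xy(2-) by cases auto
next
  assume ?R
  then show ?L using assms unfolding edges_amalg_complete[OF assms(1) less_imp_le[OF assms(2)]]
    by blast
qed

text \<open>
  The term \<open>y = u\<close> is the label of \<open>u\<close> itself, so the weight becomes a single sum.
\<close>

lemma weight_eq_closed_neighbourhood_sum:
  assumes "u \<in> verts (amalg_complete m n r)" "0 < m" "r < n"
  shows "weight (amalg_complete m n r) (total_label m n r) u =
    (\<Sum>y\<in>{y \<in> verts (amalg_complete m n r). snd u < r \<or> snd y < r \<or> fst u = fst y}.
      set_label m n r {u, y})"
proof -
  let ?G = "amalg_complete m n r"
  let ?C = "{y \<in> verts ?G. snd u < r \<or> snd y < r \<or> fst u = fst y}"
  have fin: "finite (verts ?G)" and E: "edges ?G \<subseteq> {e. e \<subseteq> verts ?G \<and> card e = 2}"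
    using fin_simple_graph_amalg_complete[of m r n] assms by (auto simp: fin_simple_graph_def)
  have "{e \<in> edges ?G. u \<in> e} = (\<lambda>y. {u, y}) ` (?C - {u})"
  proof (intro equalityI subsetI)
    fix e assume e: "e \<in> {e \<in> edges ?G. u \<in> e}"
    then have "card e = 2" using E by auto
    then obtain y where "e = {u, y}" using e by (auto simp: card_2_iff)
    then show "e \<in> (\<lambda>y. {u, y}) ` (?C - {u})"
      using e assms by (auto simp: doubleton_in_edges_iff)
  next
    fix e assume "e \<in> (\<lambda>y. {u, y}) ` (?C - {u})"
    then show "e \<in> {e \<in> edges ?G. u \<in> e}"
      using assms by (auto simp: doubleton_in_edges_iff)
  qed
  moreover have "inj_on (\<lambda>y. {u, y}) (?C - {u})" by (auto simp: inj_on_def doubleton_eq_iff)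
  ultimately have "(\<Sum>e\<in>{e \<in> edges ?G. u \<in> e}. total_label m n r (Inr e)) =
      (\<Sum>y\<in>?C - {u}. set_label m n r {u, y})"
    by (simp add: sum.reindex total_label_def)
  then have "weight ?G (total_label m n r) u =
      set_label m n r {u, u} + (\<Sum>y\<in>?C - {u}. set_label m n r {u, y})"
    by (simp add: weight_def total_label_def)
  also have "\<dots> = (\<Sum>y\<in>?C. set_label m n r {u, y})"
    using fin assms by (intro sum.remove[symmetric]) auto
  finally show ?thesis .
qed

lemma weight_outside_hub:
  assumes "r \<le> v" "v < n" "i < m"
  shows "weight (amalg_complete m n r) (total_label m n r) (i, v) =
    (\<Sum>b<n. pair_label m n r i v b)"
proof -
  let ?g = "\<lambda>b. glue {..<r} (i, b)"
  have V: "verts (amalg_complete m n r) = {0} \<times> {..<r} \<union> {..<m} \<times> {r..<n}"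
    using assms by (simp add: verts_amalg_complete)
  have inj: "inj_on ?g {..<n}" by (auto simp: inj_on_def glue_def split: if_splits)
  have C: "{y \<in> verts (amalg_complete m n r). snd (i, v) < r \<or> snd y < r \<or> fst (i, v) = fst y}
      = ?g ` {..<n}" (is "?C = _")
  proof (intro equalityI subsetI)
    fix y assume "y \<in> ?C"
    then have "y = ?g (snd y)" "snd y < n" using assms by (auto simp: V glue_def)
    then show "y \<in> ?g ` {..<n}" by blast
  qed (use assms in \<open>auto simp: V glue_def\<close>)
  have "weight (amalg_complete m n r) (total_label m n r) (i, v) =
      (\<Sum>y\<in>?g ` {..<n}. set_label m n r {(i, v), y})"
    unfolding C[symmetric] using assms
    by (intro weight_eq_closed_neighbourhood_sum) (auto simp: V)
  also have "\<dots> = (\<Sum>b<n. set_label m n r (copy_pair r i v b))"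
    using assms by (simp only: sum.reindex[OF inj]) (simp add: copy_pair_def glue_def)
  finally show ?thesis by (simp add: set_label_copy_pair)
qed

lemma weight_in_hub:
  assumes "v < r" "r < n" "0 < m"
  shows "weight (amalg_complete m n r) (total_label m n r) (0, v) =
    (\<Sum>b<r. pair_label m n r 0 v b) + (\<Sum>b = r..<n. \<Sum>i<m. pair_label m n r i v b)"
proof -
  let ?V = "{0} \<times> {..<r} \<union> {..<m} \<times> {r..<n}"
  have V: "verts (amalg_complete m n r) = ?V" using assms by (simp add: verts_amalg_complete)
  have v: "(0, v) \<in> ?V" using assms by simp
  have "weight (amalg_complete m n r) (total_label m n r) (0, v) =
      (\<Sum>y\<in>?V. set_label m n r {(0, v), y})"
    using assms weight_eq_closed_neighbourhood_sum[of "(0, v)" m n r] v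
    unfolding V by (simp del: Un_iff)
  also have "\<dots> =
      (\<Sum>y\<in>{0} \<times> {..<r}. set_label m n r {(0, v), y}) +
      (\<Sum>y\<in>{..<m} \<times> {r..<n}. set_label m n r {(0, v), y})"
    by (intro sum.union_disjoint) auto
  also have "\<dots> = (\<Sum>b<r. pair_label m n r 0 v b) +
      (\<Sum>i<m. \<Sum>b = r..<n. pair_label m n r i v b)"
    by (simp add: sum.cartesian_product' set_label_doubleton)
  also have "(\<Sum>i<m. \<Sum>b = r..<n. pair_label m n r i v b) =
      (\<Sum>b = r..<n. \<Sum>i<m. pair_label m n r i v b)"
    by (rule sum.swap)
  finally show ?thesis .
qed

text \<open>
  Entrywise comparison of rows \<open>u\<close> and \<open>v\<close>. Strictness is taken from a position outside the hub,
  which exists because \<open>r < n\<close>.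
\<close>

lemma weight_strict_antimono:
  assumes "u < v" "v < n" "r < n" "0 < m"
  shows "weight (amalg_complete m n r) (total_label m n r) (0, v) <
    weight (amalg_complete m n r) (total_label m n r) (0, u)"
proof -
  let ?F = "pair_label m n r"
  have less: "?F j v b < ?F i u b" if "b < n" "i < m" "j < m" for i j b
    using pair_label_strict_antimono assms that by blast
  have row: "(\<Sum>b<n. g b) = (\<Sum>b<r. g b) + (\<Sum>b = r..<n. g b)" for g :: "nat \<Rightarrow> nat"
    using assms sum.atLeastLessThan_concat[of 0 r n g] by (simp add: atLeast0LessThan)
  have hub: "(\<Sum>b<r. ?F 0 v b) \<le> (\<Sum>b<r. ?F 0 u b)"
    using assms by (intro sum_mono less_imp_le less) auto
  consider "v < r" | "u < r" "r \<le> v" | "r \<le> u" using assms by linarith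
  then show ?thesis
  proof cases
    case 1
    have "(\<Sum>b = r..<n. \<Sum>i<m. ?F i v b) < (\<Sum>b = r..<n. \<Sum>i<m. ?F i u b)"
      using assms by (intro sum_strict_mono less) auto
    with hub show ?thesis using 1 assms by (simp add: weight_in_hub)
  next
    case 2
    \<comment> \<open>The single entry of copy \<open>0\<close> in row \<open>u\<close> already exceeds the entry of row \<open>v\<close>.\<close>
    have "?F 0 v b < (\<Sum>i<m. ?F i u b)" if "b < n" for b
      using less[OF that assms(4,4)] member_le_sum[of 0 "{..<m}" "\<lambda>i. ?F i u b"] assms by simp
    then have "(\<Sum>b = r..<n. ?F 0 v b) < (\<Sum>b = r..<n. \<Sum>i<m. ?F i u b)"
      using assms by (intro sum_strict_mono) auto
    with hub show ?thesis using 2 assms by (simp add: weight_in_hub weight_outside_hub row)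
  next
    case 3
    have "(\<Sum>b<n. ?F 0 v b) < (\<Sum>b<n. ?F 0 u b)"
      using assms by (intro sum_strict_mono less) auto
    then show ?thesis using 3 assms by (simp add: weight_outside_hub)
  qed
qed

lemma weight_depends_on_column:
  assumes "x \<in> verts (amalg_complete m n r)" "even n" "r < n" "0 < m"
  shows "weight (amalg_complete m n r) (total_label m n r) x =
    weight (amalg_complete m n r) (total_label m n r) (0, snd x)"
proof (cases "snd x < r")
  case True
  then show ?thesis using assms by (auto simp: verts_amalg_complete)
next
  case False
  then obtain i v where "x = (i, v)" "i < m" "r \<le> v" "v < n"
    using assms by (auto simp: verts_amalg_complete)
  then show ?thesis using assms pair_label_row_sum[of n i m 0 r v]
    by (simp add: weight_outside_hub)
qed

section \<open>The local antimagic total chromatic number\<close>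

lemma card_weights_ge:
  assumes "local_antimagic_total (amalg_complete m n r) f" "r < n" "0 < m"
  shows "n \<le> card (weight (amalg_complete m n r) f ` verts (amalg_complete m n r))"
proof -
  let ?G = "amalg_complete m n r"
  have sub: "{0} \<times> {..<n} \<subseteq> verts ?G" using assms by (auto simp: verts_amalg_complete)
  have "inj_on (weight ?G f) ({0} \<times> {..<n})"
  proof (rule inj_onI, rule ccontr)
    fix x y assume xy: "x \<in> {0} \<times> {..<n}" "y \<in> {0} \<times> {..<n}" "x \<noteq> y"
      and eq: "weight ?G f x = weight ?G f y"
    have "fst x = fst y" using xy by auto
    then have "{x, y} \<in> edges ?G" using xy sub assms by (auto simp: doubleton_in_edges_iff)
    with eq assms(1) show False unfolding local_antimagic_total_def by blast
  qed
  then have "n = card (weight ?G f ` ({0} \<times> {..<n}))" by (simp add: card_image)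
  also have "\<dots> \<le> card (weight ?G f ` verts ?G)"
    using sub assms fin_simple_graph_amalg_complete[of m r n]
    by (intro card_mono image_mono) (auto simp: fin_simple_graph_def)
  finally show ?thesis .
qed

theorem theorem2p3:
  fixes m n r :: nat
  assumes "2 \<le> m" and "even n" and "0 < n" and "r < n"
  shows "chi_lat (amalg_complete m n r) = n"
proof -
  let ?G = "amalg_complete m n r" and ?f = "total_label m n r"
  let ?W = "\<lambda>v. weight ?G ?f (0, v)"
  have m: "0 < m" using assms by simp
  have "?W v < ?W u" if "u < v" "v < n" for u v
    using weight_strict_antimono assms(4) m that by blast
  then have inj: "inj_on ?W {..<n}"
    by (metis (mono_tags, lifting) inj_onI lessThan_iff less_irrefl linorder_neqE_nat)
  have col: "weight ?G ?f x = ?W (snd x)" "snd x < n" if "x \<in> verts ?G" for x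
    using weight_depends_on_column that assms m by (auto simp: verts_amalg_complete)
  have "local_antimagic_total ?G ?f"
    unfolding local_antimagic_total_def
  proof (intro conjI allI impI)
    show "bij_betw ?f (verts ?G <+> edges ?G) {1..card (verts ?G) + card (edges ?G)}"
      using bij_betw_total_label m assms by blast
    fix x y assume "{x, y} \<in> edges ?G"
    then have "x \<in> verts ?G" "y \<in> verts ?G" "snd x \<noteq> snd y"
      using assms m by (auto simp: doubleton_in_edges_iff verts_amalg_complete)
    then show "weight ?G ?f x \<noteq> weight ?G ?f y"
      using col inj by (metis inj_onD lessThan_iff)
  qed
  moreover have "card (weight ?G ?f ` verts ?G) = n"
  proof -
    have "snd ` verts ?G = {..<n}" using assms m by (force simp: verts_amalg_complete)
    then have "weight ?G ?f ` verts ?G = ?W ` {..<n}"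
      using col(1) by (metis (no_types, lifting) image_cong image_image)
    then show ?thesis using inj by (simp add: card_image)
  qed
  ultimately show ?thesis
    unfolding chi_lat_def using card_weights_ge assms m by (intro Least_equality) blast+
qed

end
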